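(* Let $f(x)=\sum_{k=1}^n\gamma_k h_k(x)$, $x\in\mathbb{R}$, be a finite Gaussian mixture. Let $W_0=1$, $W_j=W(h_1,\dots,h_j)$ for $1\le j\le n$, and let $\psi_0=f$ and $$\psi_j=\frac{W_j}{W_{j-1}}\,D\left(\frac{W_{j-1}}{W_j}\,\psi_{j-1}\right),\qquad 1\le j\le n,$$ be the Generalized Budan-Fourier sequence obtained using the Polya-Ristroph formula. Then $\psi_0=f$ and, for all $1\le j<n$, $$\psi_j(x)=\sum_{k=j+1}^n\gamma_k\,\frac{Q^{j}_{1,\dots,j,k}(x)}{Q^{j-1}_{1,\dots,j}(x)}\,h_k(x)$$ (equality holding at all $x$ at which none of the denominators involved vanishes, i.e. as quotients of real analytic functions).
   Context: $D$ denotes differentiation with respect to $x$. A finite Gaussian mixture is a function $f(x)=\sum_{k=1}^n\gamma_kh_k(x)$ with $h_k(x)=e^{-(x-\mu_k)^2/(2\sigma_k^2)}$, $\mu_k\in\mathbb{R}$, $\sigma_k>0$, and coefficients $\gamma_k\in\mathbb{R}$ of arbitrary sign satisfying $\sum_{k=1}^n\sigma_k\gamma_k=\frac1{\sqrt{2\pi}}$. It is assumed that $h_i\ne h_j$ for $i\ne j$. The Wronskian $W(h_1,\dots,h_m)$ is the determinant of the $m\times m$ matrix whose $(i,j)$ entry is $D^{i-1}h_j$. Let $H_0(x)=1$ and $H_m(x)=(-1)^m e^{x^2/2}D^m e^{-x^2/2}$ be the Hermite polynomials and $$P_{m,k}(x)=\frac{(-1)^m}{\sigma_k^m}H_m\left(\frac{x-\mu_k}{\sigma_k}\right),\qquad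 m\ge 0,$$ so that $D^mh_k=P_{m,k}h_k$. For $j\ge1$ and increasing indices $i_1,\dots,i_j\in\{1,\dots,n\}$, $$Q^{j-1}_{i_1,\dots,i_j}=\begin{vmatrix}1&1&\dots&1\\ P_{1,i_1}&P_{1,i_2}&\dots&P_{1,i_j}\\ \vdots&\vdots&&\vdots\\ P_{j-1,i_1}&P_{j-1,i_2}&\dots&P_{j-1,i_j}\end{vmatrix},$$ a polynomial in $x$; in particular $Q^0_k=1$. *)

theory Defs
  imports "HOL-Analysis.Derivative" "Jordan_Normal_Form.Determinant"
begin

definition gauss :: "real \<Rightarrow> real \<Rightarrow> real \<Rightarrow> real" where
  "gauss \<mu> \<sigma> x = exp (- ((x - \<mu>)\<^sup>2 / (2 * \<sigma>\<^sup>2)))"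

definition hermite :: "nat \<Rightarrow> real \<Rightarrow> real" where
  "hermite m x = (- 1) ^ m * exp (x\<^sup>2 / 2) * (deriv ^^ m) (\<lambda>t. exp (- (t\<^sup>2 / 2))) x"

lemma hermite_0: "hermite 0 x = 1"
  by (simp add: hermite_def exp_minus)

definition gauss_poly :: "real \<Rightarrow> real \<Rightarrow> nat \<Rightarrow> real \<Rightarrow> real" where
  "gauss_poly \<mu> \<sigma> m x = (- 1) ^ m / \<sigma> ^ m * hermite m ((x - \<mu>) / \<sigma>)"

(* Matrix and list indices start at 0, so row i holds the i-th derivatives. *)
definition wronskian :: "(real \<Rightarrow> real) list \<Rightarrow> real \<Rightarrow> real" where
  "wronskian hs x =
     det (mat (length hs) (length hs) (\<lambda>(i, j). (deriv ^^ i) (hs ! j) x))"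

lemma wronskian_Nil: "wronskian [] x = 1"
  by (simp add: wronskian_def)

definition initial_wronskian :: "(nat \<Rightarrow> real \<Rightarrow> real) \<Rightarrow> nat \<Rightarrow> real \<Rightarrow> real" where
  "initial_wronskian h j = wronskian (map h [1..<Suc j])"

(* Q^{j-1}_{i_1,...,i_j} for the index list [i_1,...,i_j]; the superscript is
   determined by the length of the list. *)
definition gauss_Q ::
    "(nat \<Rightarrow> real) \<Rightarrow> (nat \<Rightarrow> real) \<Rightarrow> nat list \<Rightarrow> real \<Rightarrow> real" where
  "gauss_Q \<mu> \<sigma> is x =
     det (mat (length is) (length is)
       (\<lambda>(r, c). gauss_poly (\<mu> (is ! c)) (\<sigma> (is ! c)) r x))"

(* The quotients are evaluated pointwise, so the values are meaningful only where
   initial_wronskian h i is nonzero for all i up to the index of the sequence; this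
   set is open for continuous Wronskians, hence deriv is not affected by x / 0 = 0. *)
primrec budan_fourier_seq ::
    "(nat \<Rightarrow> real \<Rightarrow> real) \<Rightarrow> (real \<Rightarrow> real) \<Rightarrow> nat \<Rightarrow> real \<Rightarrow> real" where
  "budan_fourier_seq h f 0 = f"
| "budan_fourier_seq h f (Suc j) =
     (\<lambda>x. initial_wronskian h (Suc j) x / initial_wronskian h j x *
        deriv (\<lambda>t. initial_wronskian h j t / initial_wronskian h (Suc j) t *
          budan_fourier_seq h f j t) x)"

end

theory Submission
  imports Defs "HOL-Computational_Algebra.Polynomial"
begin

text \<open>
  Wherever \<open>W\<^sub>1, \<dots>, W\<^sub>j\<close> do not vanish, \<open>\<psi>\<^sub>j = W(h\<^sub>1, \<dots>, h\<^sub>j, f) / W\<^sub>j\<close>. Indeed both sides, as functions of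
  the smooth argument \<open>f\<close>, are monic linear differential operators of order \<open>j\<close> that annihilate
  \<open>h\<^sub>1, \<dots>, h\<^sub>j\<close>; the difference is an operator of order less than \<open>j\<close> with the same
  property, so it is zero because \<open>W\<^sub>j \<noteq> 0\<close>. By linearity in \<open>f\<close>, it remains to compute the
  Wronskian of \<open>h\<^sub>1, \<dots>, h\<^sub>j, h\<^sub>k\<close>, which is \<open>Q\<^sup>j h\<^sub>1 \<cdots> h\<^sub>j h\<^sub>k\<close> since
  the column of each \<open>h\<^sub>i\<close> has \<open>h\<^sub>i\<close> as a common factor.
\<close>

subsection \<open>Determinants\<close>

lemma field_differentiable_prod:
  fixes f :: "'a \<Rightarrow> 'b::real_normed_field \<Rightarrow> 'b"
  assumes "\<And>i. i \<in> I \<Longrightarrow> f i field_differentiable (at x within S)"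
  shows "(\<lambda>z. \<Prod>i\<in>I. f i z) field_differentiable (at x within S)"
  using assms
  by (induction I rule: infinite_finite_induct) (auto intro: field_differentiable_mult)

text \<open>By the Leibniz formula the determinant is a finite sum of finite products of
  entries.\<close>

lemma field_differentiable_det:
  fixes A :: "real \<Rightarrow> real mat"
  assumes "\<And>t. A t \<in> carrier_mat m m"
    and "\<And>i j. i < m \<Longrightarrow> j < m \<Longrightarrow> (\<lambda>t. A t $$ (i, j)) field_differentiable (at x within S)"
  shows "(\<lambda>t. det (A t)) field_differentiable (at x within S)"
  unfolding det_def'[OF assms(1)]
  by (intro field_differentiable_sum field_differentiable_mult field_differentiable_const
      field_differentiable_prod assms(2)) (auto simp: permutes_in_image)

text \<open>A permutation meets every column exactly once, so each term of the Leibniz formula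
  carries the same factor \<open>\<Prod>j<m. d j\<close>.\<close>

lemma det_mat_scale_columns:
  fixes M :: "nat \<Rightarrow> nat \<Rightarrow> 'a::comm_ring_1"
  shows "det (mat m m (\<lambda>(i, j). M i j * d j)) = det (mat m m (\<lambda>(i, j). M i j)) * (\<Prod>j<m. d j)"
proof -
  have "(\<Prod>i = 0..<m. mat m m (\<lambda>(i, j). M i j * d j) $$ (i, p i)) =
      (\<Prod>i = 0..<m. mat m m (\<lambda>(i, j). M i j) $$ (i, p i)) * (\<Prod>j<m. d j)"
    if "p permutes {0..<m}" for p
  proof -
    have "(\<Prod>i = 0..<m. mat m m (\<lambda>(i, j). M i j * d j) $$ (i, p i)) =
        (\<Prod>i = 0..<m. M i (p i)) * (\<Prod>i = 0..<m. d (p i))"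
      unfolding prod.distrib[symmetric]
      using that by (intro prod.cong) (auto simp: permutes_in_image)
    also have "(\<Prod>i = 0..<m. d (p i)) = (\<Prod>j<m. d j)"
      using prod.permute[OF that, of d] by (simp add: o_def atLeast0LessThan)
    also have "(\<Prod>i = 0..<m. M i (p i)) = (\<Prod>i = 0..<m. mat m m (\<lambda>(i, j). M i j) $$ (i, p i))"
      using that by (intro prod.cong) (auto simp: permutes_in_image)
    finally show ?thesis .
  qed
  then show ?thesis
    unfolding det_def'[OF mat_carrier] sum_distrib_right mult.assoc
    by (intro sum.cong refl) (simp only: mem_Collect_eq)
qed

text \<open>The coefficient vector lies in the kernel of the transpose, whose determinant is also
  nonzero. Applied to a Wronskian matrix, this shows that an operator of order less than
  \<open>m\<close> killing \<open>m\<close> functions has zero coefficients at the point.\<close>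

lemma row_combination_zero_imp_coeff_zero:
  fixes M :: "nat \<Rightarrow> nat \<Rightarrow> 'a::field"
  assumes "det (mat m m (\<lambda>(i, j). M i j)) \<noteq> 0"
    and comb: "\<And>j. j < m \<Longrightarrow> (\<Sum>i<m. b i * M i j) = 0"
    and "i < m"
  shows "b i = 0"
proof -
  let ?A = "mat m m (\<lambda>(i, j). M i j)"
  have "transpose_mat ?A *\<^sub>v vec m b = 0\<^sub>v m"
    by (intro eq_vecI)
      (auto simp: scalar_prod_def atLeast0LessThan mult.commute comb)
  moreover have "det (transpose_mat ?A) \<noteq> 0"
    using assms(1) by (simp add: det_transpose[of _ m])
  ultimately have "vec m b = 0\<^sub>v m"
    using det_0_iff_vec_prod_zero_field[of "transpose_mat ?A" m]
    by (metis (no_types, lifting) mat_carrier transpose_carrier_mat vec_carrier)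
  with \<open>i < m\<close> show ?thesis by (metis index_vec index_zero_vec(1))
qed

subsection \<open>Wronskians as differential operators\<close>

text \<open>Since \<open>deriv\<close> is total, its iterates always exist as functions;
  differentiability of each iterate makes them genuine derivatives.\<close>

definition infinitely_differentiable :: "(real \<Rightarrow> real) \<Rightarrow> bool" where
  "infinitely_differentiable g \<longleftrightarrow> (\<forall>i x. (deriv ^^ i) g field_differentiable at x)"

lemma infinitely_differentiableD:
  "infinitely_differentiable g \<Longrightarrow> (deriv ^^ i) g field_differentiable at x"
  by (simp add: infinitely_differentiable_def)

lemma infinitely_differentiable_has_field_derivative:
  assumes "infinitely_differentiable g"
  shows "((deriv ^^ i) g has_field_derivative (deriv ^^ Suc i) g x) (at x)"
  using infinitely_differentiableD[OF assms] DERIV_deriv_iff_field_differentiable by fastforce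

lemma higher_deriv_linear_combination:
  assumes "\<And>k. k \<in> K \<Longrightarrow> infinitely_differentiable (h k)"
  shows "(deriv ^^ i) (\<lambda>x. \<Sum>k\<in>K. \<gamma> k * h k x) = (\<lambda>x. \<Sum>k\<in>K. \<gamma> k * (deriv ^^ i) (h k) x)"
proof (induction i)
  case 0
  then show ?case by simp
next
  case (Suc i)
  have "((\<lambda>x. \<Sum>k\<in>K. \<gamma> k * (deriv ^^ i) (h k) x) has_field_derivative
      (\<Sum>k\<in>K. \<gamma> k * (deriv ^^ Suc i) (h k) x)) (at x)" for x
    by (intro DERIV_sum DERIV_cmult infinitely_differentiable_has_field_derivative assms)
  then show ?case using Suc by (auto intro!: DERIV_imp_deriv)
qed

lemma infinitely_differentiable_linear_combination:
  assumes "\<And>k. k \<in> K \<Longrightarrow> infinitely_differentiable (h k)"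
  shows "infinitely_differentiable (\<lambda>x. \<Sum>k\<in>K. \<gamma> k * h k x)"
  unfolding infinitely_differentiable_def
proof (intro allI)
  fix i x
  have "(\<lambda>x. \<Sum>k\<in>K. \<gamma> k * (deriv ^^ i) (h k) x) field_differentiable at x"
    by (intro field_differentiable_sum field_differentiable_mult field_differentiable_const)
      (rule infinitely_differentiableD[OF assms])
  then show "(deriv ^^ i) (\<lambda>x. \<Sum>k\<in>K. \<gamma> k * h k x) field_differentiable at x"
    by (simp only: higher_deriv_linear_combination assms)
qed

lemma field_differentiable_wronskian:
  assumes "\<And>g. g \<in> set hs \<Longrightarrow> infinitely_differentiable g"
  shows "wronskian hs field_differentiable at x"
  unfolding wronskian_def[abs_def]
  by (rule field_differentiable_det[where m = "length hs"])
    (auto intro!: infinitely_differentiableD assms)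

text \<open>The last column repeats the column that \<open>g\<close> already has in
  \<open>hs\<close>.\<close>

lemma wronskian_append_in_set:
  assumes "g \<in> set hs"
  shows "wronskian (hs @ [g]) x = 0"
proof -
  obtain k where k: "k < length hs" "hs ! k = g"
    using assms by (meson in_set_conv_nth)
  show ?thesis
    unfolding wronskian_def
    by (rule det_identical_columns[where i = k and j = "length hs" and n = "Suc (length hs)"])
      (use k in \<open>auto simp: nth_append intro!: eq_vecI\<close>)
qed

text \<open>The function \<open>g\<close> enters only the last column, so Laplace expansion there
  gives a linear differential operator in \<open>g\<close>. Its coefficients are signed minors built
  from \<open>hs\<close> alone.\<close>

lemma wronskian_append_expansion:
  assumes "\<And>g. g \<in> set hs \<Longrightarrow> infinitely_differentiable g"
  obtains c where "\<And>i x. c i field_differentiable at x"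
    and "c (length hs) = wronskian hs"
    and "\<And>g x. wronskian (hs @ [g]) x = (\<Sum>i\<le>length hs. c i x * (deriv ^^ i) g x)"
proof
  let ?m = "length hs"
  \<comment> \<open>This is the minor without row \<open>i\<close> and the last column: the order of
    differentiation skips the value \<open>i\<close>.\<close>
  define D where "D i x = mat ?m ?m
    (\<lambda>(r, k). (deriv ^^ (if r < i then r else Suc r)) (hs ! k) x)" for i x
  define c where "c i x = (- 1) ^ (i + ?m) * det (D i x)" for i x
  show "c i field_differentiable at x" for i x
    unfolding c_def
    by (intro field_differentiable_mult field_differentiable_const
        field_differentiable_det[where m = ?m])
      (auto simp: D_def intro!: infinitely_differentiableD assms simp del: funpow.simps)
  show "c ?m = wronskian hs"
  proof
    fix x
    \<comment> \<open>For the leading coefficient no row of order below \<open>?m\<close> is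
      skipped, and the sign has the even exponent \<open>?m + ?m\<close>.\<close>
    have "D ?m x = mat ?m ?m (\<lambda>(i, j). (deriv ^^ i) (hs ! j) x)"
      by (auto simp: D_def)
    then show "c ?m x = wronskian hs x"
      by (simp add: c_def wronskian_def flip: mult_2)
  qed
  fix g x
  let ?A = "mat (Suc ?m) (Suc ?m) (\<lambda>(i, j). (deriv ^^ i) ((hs @ [g]) ! j) x)"
  have "mat_delete ?A i ?m = D i x" if "i \<le> ?m" for i
    using that by (auto simp: mat_delete_def D_def nth_append simp del: funpow.simps)
  then have "cofactor ?A i ?m = c i x" if "i \<le> ?m" for i
    using that by (simp add: cofactor_def c_def)
  moreover have "det ?A = (\<Sum>i<Suc ?m. ?A $$ (i, ?m) * cofactor ?A i ?m)"
    by (rule laplace_expansion_column) auto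
  ultimately show "wronskian (hs @ [g]) x = (\<Sum>i\<le>?m. c i x * (deriv ^^ i) g x)"
    unfolding wronskian_def by (auto simp: lessThan_Suc_atMost intro!: sum.cong)
qed

lemma wronskian_append_linear_combination:
  assumes "\<And>g. g \<in> set hs \<Longrightarrow> infinitely_differentiable g"
    and "\<And>k. k \<in> K \<Longrightarrow> infinitely_differentiable (h k)"
  shows "wronskian (hs @ [(\<lambda>x. \<Sum>k\<in>K. \<gamma> k * h k x)]) x =
    (\<Sum>k\<in>K. \<gamma> k * wronskian (hs @ [h k]) x)"
proof -
  obtain c where c: "\<And>g x. wronskian (hs @ [g]) x = (\<Sum>i\<le>length hs. c i x * (deriv ^^ i) g x)"
    using wronskian_append_expansion[OF assms(1)] by metis
  have "wronskian (hs @ [(\<lambda>x. \<Sum>k\<in>K. \<gamma> k * h k x)]) x =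
      (\<Sum>i\<le>length hs. \<Sum>k\<in>K. \<gamma> k * (c i x * (deriv ^^ i) (h k) x))"
    by (simp add: c higher_deriv_linear_combination assms(2) sum_distrib_left mult.left_commute)
  also have "\<dots> = (\<Sum>k\<in>K. \<gamma> k * wronskian (hs @ [h k]) x)"
    by (subst sum.swap) (simp add: c sum_distrib_left)
  finally show ?thesis .
qed

lemma wronskian_mult_scaled_columns:
  assumes "\<And>i j. i < length hs \<Longrightarrow> j < length hs \<Longrightarrow> (deriv ^^ i) (hs ! j) x = P i j * (hs ! j) x"
  shows "wronskian hs x =
    det (mat (length hs) (length hs) (\<lambda>(i, j). P i j)) * (\<Prod>j<length hs. (hs ! j) x)"
  unfolding wronskian_def det_mat_scale_columns[symmetric]
  by (intro arg_cong[where f = det] eq_matI) (auto simp: assms)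

section \<open>The Budan-Fourier sequence as a quotient of Wronskians\<close>

lemma initial_wronskian_0: "initial_wronskian h 0 x = 1"
  by (simp add: initial_wronskian_def wronskian_Nil)

lemma field_differentiable_initial_wronskian:
  assumes "\<And>k. k \<in> {1..j} \<Longrightarrow> infinitely_differentiable (h k)"
  shows "initial_wronskian h j field_differentiable at x"
  unfolding initial_wronskian_def
  by (rule field_differentiable_wronskian) (use assms in auto)

text \<open>Nonvanishing is an open condition by continuity, so identities between quotients hold on
  a neighbourhood and may be used under \<open>deriv\<close>.\<close>

lemma eventually_initial_wronskian_nonzero:
  assumes "\<And>k. k \<in> {1..j} \<Longrightarrow> infinitely_differentiable (h k)"
    and "initial_wronskian h j x \<noteq> 0"
  shows "eventually (\<lambda>t. initial_wronskian h j t \<noteq> 0) (nhds x)"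
proof -
  have "isCont (initial_wronskian h j) x"
    by (intro field_differentiable_imp_continuous_at field_differentiable_initial_wronskian assms)
  then show ?thesis
    using assms(2) by (simp add: isCont_def tendsto_at_iff_tendsto_nhds tendsto_imp_eventually_ne)
qed

lemma initial_wronskian_Suc:
  "initial_wronskian h (Suc j) = wronskian (map h [1..<Suc j] @ [h (Suc j)])"
  by (simp add: initial_wronskian_def)

lemma budan_fourier_seq_eq_wronskian:
  assumes "\<And>k. k \<in> {1..j} \<Longrightarrow> infinitely_differentiable (h k)"
    and "infinitely_differentiable g"
    and "\<And>i. i \<in> {1..j} \<Longrightarrow> initial_wronskian h i x \<noteq> 0"
  shows "budan_fourier_seq h g j x =
    wronskian (map h [1..<Suc j] @ [g]) x / initial_wronskian h j x"
  using assms
\<comment> \<open>The induction hypothesis is used at all points near \<open>x\<close>, and for each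
  \<open>h k\<close> as well as for \<open>g\<close>.\<close>
proof (induction j arbitrary: g x)
  case 0
  then show ?case by (simp add: wronskian_def det_single initial_wronskian_0)
next
  case (Suc j)
  let ?H = "map h [1..<Suc j]" and ?H' = "map h [1..<Suc (Suc j)]"
  let ?W = "initial_wronskian h j" and ?W' = "initial_wronskian h (Suc j)"
  have smooth: "infinitely_differentiable (h k)" if "k \<in> {1..Suc j}" for k
    using Suc.prems(1) that by blast
  have ev_nz: "eventually (\<lambda>t. \<forall>i\<in>{1..Suc j}. initial_wronskian h i t \<noteq> 0) (nhds x)"
    by (intro eventually_ball_finite ballI eventually_initial_wronskian_nonzero Suc.prems smooth)
      auto
  \<comment> \<open>The assumption starts at index 1; for \<open>j = 0\<close> the Wronskian
    \<open>?W\<close> is the constant 1.\<close>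
  have W_nz: "?W x \<noteq> 0" "?W' x \<noteq> 0"
    using Suc.prems(3) by (cases j; simp add: initial_wronskian_0)+
  \<comment> \<open>Near \<open>x\<close> the induction hypothesis applies and the factor
    \<open>?W\<close> cancels inside the derivative.\<close>
  have eq: "budan_fourier_seq h u (Suc j) x =
      ?W' x / ?W x * deriv (\<lambda>t. wronskian (?H @ [u]) t / ?W' t) x"
    if u: "infinitely_differentiable u" for u
  proof -
    have "eventually (\<lambda>t. ?W t / ?W' t * budan_fourier_seq h u j t =
        wronskian (?H @ [u]) t / ?W' t) (nhds x)"
      using ev_nz
    proof eventually_elim
      case (elim t)
      then have "?W t \<noteq> 0"
        by (cases j) (auto simp: initial_wronskian_0)
      moreover have "budan_fourier_seq h u j t = wronskian (?H @ [u]) t / ?W t"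
        using elim by (intro Suc.IH u) (auto intro: smooth)
      ultimately show ?case by simp
    qed
    then show ?thesis by (simp add: deriv_cong_ev)
  qed
  obtain c where c: "\<And>i x. c i field_differentiable at x" "c j = ?W"
    "\<And>g x. wronskian (?H @ [g]) x = (\<Sum>i\<le>j. c i x * (deriv ^^ i) g x)"
    by (rule wronskian_append_expansion[of ?H])
      (auto simp: smooth initial_wronskian_def simp del: upt_Suc)
  obtain c' where c': "c' (Suc j) = ?W'"
    "\<And>g x. wronskian (?H' @ [g]) x = (\<Sum>i\<le>Suc j. c' i x * (deriv ^^ i) g x)"
    by (rule wronskian_append_expansion[of ?H'])
      (auto simp: smooth initial_wronskian_def simp del: upt_Suc)
  define e where "e i t = c i t / ?W' t" for i t
  have e: "(e i has_field_derivative deriv (e i) x) (at x)" for i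
    unfolding DERIV_deriv_iff_field_differentiable e_def
    by (intro field_differentiable_divide c field_differentiable_initial_wronskian smooth W_nz)
  \<comment> \<open>The leading coefficient \<open>e j x\<close> equals \<open>?W x / ?W' x\<close>,
    so the outer factor \<open>q\<close> of the recursion normalizes it to 1.\<close>
  define q where "q = ?W' x / ?W x"
  have q: "q * (y * e j x) = y" for y
    using W_nz by (simp add: q_def e_def c(2))
  \<comment> \<open>By the product rule, order \<open>i\<close> receives the derivative of
    \<open>e i\<close> and the shifted coefficient \<open>e (i - 1)\<close>; for
    \<open>i = 0\<close> nothing is shifted in.\<close>
  define a where "a i = q * (deriv (e i) x + (if i = 0 then 0 else e (i - 1) x))" for i
  have monic: "budan_fourier_seq h u (Suc j) x =
      (\<Sum>i\<le>j. a i * (deriv ^^ i) u x) + (deriv ^^ Suc j) u x"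
    if u: "infinitely_differentiable u" for u
  proof -
    have "((\<lambda>t. \<Sum>i\<le>j. e i t * (deriv ^^ i) u t) has_field_derivative
        (\<Sum>i\<le>j. deriv (e i) x * (deriv ^^ i) u x + (deriv ^^ Suc i) u x * e i x)) (at x)"
      by (intro DERIV_sum DERIV_mult e infinitely_differentiable_has_field_derivative u)
    then have "deriv (\<lambda>t. wronskian (?H @ [u]) t / ?W' t) x =
        (\<Sum>i\<le>j. deriv (e i) x * (deriv ^^ i) u x + (deriv ^^ Suc i) u x * e i x)"
      by (intro DERIV_imp_deriv) (simp add: c(3) e_def sum_divide_distrib
          del: upt_Suc funpow.simps One_nat_def)
    also have "\<dots> = (\<Sum>i\<le>j. deriv (e i) x * (deriv ^^ i) u x) +
        (\<Sum>i<Suc j. (deriv ^^ Suc i) u x * e i x)"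
      by (simp add: sum.distrib lessThan_Suc_atMost)
    \<comment> \<open>Reindex by the order of differentiation; the new term at \<open>i = 0\<close>
      is zero.\<close>
    also have "(\<Sum>i<Suc j. (deriv ^^ Suc i) u x * e i x) =
        (\<Sum>i<Suc (Suc j). (deriv ^^ i) u x * (if i = 0 then 0 else e (i - 1) x))"
      by (subst (2) sum.lessThan_Suc_shift) simp
    also have "\<dots> = (\<Sum>i\<le>j. (deriv ^^ i) u x * (if i = 0 then 0 else e (i - 1) x))
        + (deriv ^^ Suc j) u x * e j x"
      by (simp add: lessThan_Suc_atMost del: funpow.simps)
    also have "(\<Sum>i\<le>j. deriv (e i) x * (deriv ^^ i) u x) + \<dots> =
        (\<Sum>i\<le>j. (deriv (e i) x + (if i = 0 then 0 else e (i - 1) x)) * (deriv ^^ i) u x)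
        + (deriv ^^ Suc j) u x * e j x"
      by (simp add: algebra_simps sum.distrib del: funpow.simps)
    finally have deriv_eq: "deriv (\<lambda>t. wronskian (?H @ [u]) t / ?W' t) x = \<dots>" .
    show ?thesis
      unfolding eq[OF u] deriv_eq q_def[symmetric] a_def mult.assoc[of q]
      by (simp only: distrib_left[of q "sum F A" for F A] q sum_distrib_left)
  qed
  \<comment> \<open>For \<open>k = Suc j\<close> the quotient under \<open>deriv\<close> is locally
    \<open>?W' / ?W' = 1\<close>; for smaller \<open>k\<close> its numerator has a repeated
    column.\<close>
  have annihilates: "budan_fourier_seq h (h k) (Suc j) x = 0" if k: "k \<in> {1..Suc j}" for k
  proof -
    have "deriv (\<lambda>t. wronskian (?H @ [h k]) t / ?W' t) x = 0"
    proof (cases "k = Suc j")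
      case True
      have "eventually (\<lambda>t. wronskian (?H @ [h k]) t / ?W' t = 1) (nhds x)"
        using ev_nz unfolding True initial_wronskian_Suc[symmetric]
        by eventually_elim auto
      then have "deriv (\<lambda>t. wronskian (?H @ [h k]) t / ?W' t) x = deriv (\<lambda>t. 1) x"
        by (rule deriv_cong_ev) simp
      then show ?thesis by simp
    next
      case False
      then have "h k \<in> set ?H" using k by (auto simp del: upt_Suc)
      then show ?thesis by (simp add: wronskian_append_in_set)
    qed
    then show ?thesis using eq[OF smooth[OF k]] by simp
  qed
  \<comment> \<open>Both operators are monic of order \<open>Suc j\<close>, so their leading terms
    cancel in the difference. What remains combines the rows of the Wronskian matrix of
    \<open>?H'\<close> to zero.\<close>
  have coeff: "a i - c' i x / ?W' x = 0" if "i < Suc j" for i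
  proof (rule row_combination_zero_imp_coeff_zero[where m = "Suc j" and
        M = "\<lambda>i k. (deriv ^^ i) (?H' ! k) x" and b = "\<lambda>i. a i - c' i x / ?W' x", OF _ _ that])
    show "det (mat (Suc j) (Suc j) (\<lambda>(i, k). (deriv ^^ i) (?H' ! k) x)) \<noteq> 0"
      using W_nz(2) by (simp add: initial_wronskian_def wronskian_def del: upt_Suc)
    fix k assume "k < Suc j"
    \<comment> \<open>List positions count from 0, the functions \<open>h\<close> from 1.\<close>
    then have nth: "?H' ! k = h (Suc k)" and mem: "h (Suc k) \<in> set ?H'"
      and k: "Suc k \<in> {1..Suc j}"
      by (auto simp del: upt_Suc)
    have "(\<Sum>i\<le>j. a i * (deriv ^^ i) (h (Suc k)) x) + (deriv ^^ Suc j) (h (Suc k)) x = 0"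
      using monic[OF smooth[OF k]] annihilates[OF k] by simp
    moreover have "(\<Sum>i\<le>j. c' i x / ?W' x * (deriv ^^ i) (h (Suc k)) x)
        + (deriv ^^ Suc j) (h (Suc k)) x = wronskian (?H' @ [h (Suc k)]) x / ?W' x"
      using W_nz by (simp add: c' add_divide_distrib sum_divide_distrib del: funpow.simps upt_Suc One_nat_def)
    moreover have "wronskian (?H' @ [h (Suc k)]) x = 0"
      by (rule wronskian_append_in_set[OF mem])
    ultimately show "(\<Sum>i<Suc j. (a i - c' i x / ?W' x) * (deriv ^^ i) (?H' ! k) x) = 0"
      unfolding nth by (simp add: left_diff_distrib sum_subtractf lessThan_Suc_atMost
          del: funpow.simps upt_Suc One_nat_def)
  qed
  have "budan_fourier_seq h g (Suc j) x =
      (\<Sum>i\<le>j. c' i x / ?W' x * (deriv ^^ i) g x) + (deriv ^^ Suc j) g x"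
    using coeff by (simp add: monic[OF Suc.prems(2)] del: funpow.simps budan_fourier_seq.simps)
  also have "\<dots> = wronskian (?H' @ [g]) x / ?W' x"
    using W_nz by (simp add: c' add_divide_distrib sum_divide_distrib del: funpow.simps upt_Suc One_nat_def)
  finally show ?case .
qed

subsection \<open>Gaussians\<close>

text \<open>Differentiation turns the polynomial factor p into p' - t p, with
  \<open>pCons 0 p\<close> standing for t p. This shape gives smoothness of the Gaussian.\<close>

lemma higher_deriv_exp_neg_sq:
  "\<exists>p. (deriv ^^ m) (\<lambda>t::real. exp (- (t\<^sup>2 / 2))) = (\<lambda>t. poly p t * exp (- (t\<^sup>2 / 2)))"
proof (induction m)
  case 0
  show ?case by (rule exI[of _ 1]) simp
next
  case (Suc m)
  then obtain p where
    p: "(deriv ^^ m) (\<lambda>t::real. exp (- (t\<^sup>2 / 2))) = (\<lambda>t. poly p t * exp (- (t\<^sup>2 / 2)))"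
    by blast
  have "((\<lambda>t. poly p t * exp (- (t\<^sup>2 / 2))) has_field_derivative
      poly (pderiv p - pCons 0 p) t * exp (- (t\<^sup>2 / 2))) (at t)" for t
    by (auto intro!: derivative_eq_intros simp: algebra_simps)
  then show ?case using p by (auto intro!: exI[of _ "pderiv p - pCons 0 p"] DERIV_imp_deriv)
qed

lemma infinitely_differentiable_exp_neg_sq: "infinitely_differentiable (\<lambda>t. exp (- (t\<^sup>2 / 2)))"
  unfolding infinitely_differentiable_def
proof (intro allI)
  fix i and x :: real
  obtain p where "(deriv ^^ i) (\<lambda>t::real. exp (- (t\<^sup>2 / 2))) = (\<lambda>t. poly p t * exp (- (t\<^sup>2 / 2)))"
    using higher_deriv_exp_neg_sq by blast
  then show "(deriv ^^ i) (\<lambda>t. exp (- (t\<^sup>2 / 2))) field_differentiable at x"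
    unfolding field_differentiable_def by (auto intro!: exI derivative_eq_intros)
qed

lemma gauss_eq: "gauss \<mu> \<sigma> x = exp (- (((x - \<mu>) / \<sigma>)\<^sup>2 / 2))"
  by (simp add: gauss_def power_divide mult.commute)

text \<open>Each differentiation contributes a factor \<open>1 / \<sigma>\<close> by the chain rule.
  For \<open>\<sigma> = 0\<close> the function is constant and the stated derivative is 0, as
  \<open>x / 0 = 0\<close>.\<close>

lemma has_field_derivative_higher_deriv_standardized:
  assumes "infinitely_differentiable \<phi>"
  shows "((\<lambda>x. (deriv ^^ m) \<phi> ((x - \<mu>) / \<sigma>) / \<sigma> ^ m) has_field_derivative
    (deriv ^^ Suc m) \<phi> ((x - \<mu>) / \<sigma>) / \<sigma> ^ Suc m) (at x)"
proof -
  have "((\<lambda>x. (x - \<mu>) / \<sigma>) has_field_derivative 1 / \<sigma>) (at x)"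
    by (intro DERIV_cdivide) (auto intro!: derivative_eq_intros)
  from DERIV_cdivide[OF DERIV_chain2[OF infinitely_differentiable_has_field_derivative[OF assms] this]]
  show ?thesis by (rule DERIV_cong) (simp add: mult.commute)
qed

lemma higher_deriv_gauss:
  "(deriv ^^ m) (gauss \<mu> \<sigma>) =
    (\<lambda>x. (deriv ^^ m) (\<lambda>t. exp (- (t\<^sup>2 / 2))) ((x - \<mu>) / \<sigma>) / \<sigma> ^ m)"
proof (induction m)
  case 0
  then show ?case by (auto simp: gauss_eq)
next
  case (Suc m)
  from DERIV_imp_deriv[OF has_field_derivative_higher_deriv_standardized
      [OF infinitely_differentiable_exp_neg_sq]] Suc
  show ?case by simp
qed

text \<open>The signs in \<open>gauss_poly\<close> and \<open>hermite\<close> cancel, and the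
  growing exponential in \<open>hermite\<close> cancels the factor
  \<open>gauss \<mu> \<sigma> x\<close>.\<close>

lemma higher_deriv_gauss_eq_gauss_poly:
  "(deriv ^^ m) (gauss \<mu> \<sigma>) x = gauss_poly \<mu> \<sigma> m x * gauss \<mu> \<sigma> x"
proof -
  have "(- 1) ^ m * (- 1) ^ m = (1 :: real)"
    by (simp flip: power_mult_distrib)
  then show ?thesis
    by (simp add: higher_deriv_gauss gauss_poly_def hermite_def gauss_eq exp_minus divide_simps)
qed

lemma infinitely_differentiable_gauss: "infinitely_differentiable (gauss \<mu> \<sigma>)"
  unfolding infinitely_differentiable_def higher_deriv_gauss field_differentiable_def
  using has_field_derivative_higher_deriv_standardized[OF infinitely_differentiable_exp_neg_sq] by blast

lemma wronskian_gauss: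
  "wronskian (map (\<lambda>k. gauss (\<mu> k) (\<sigma> k)) is) x =
    gauss_Q \<mu> \<sigma> is x * (\<Prod>k\<leftarrow>is. gauss (\<mu> k) (\<sigma> k) x)"
proof -
  have "wronskian (map (\<lambda>k. gauss (\<mu> k) (\<sigma> k)) is) x =
      gauss_Q \<mu> \<sigma> is x * (\<Prod>j<length is. gauss (\<mu> (is ! j)) (\<sigma> (is ! j)) x)"
    using wronskian_mult_scaled_columns[of "map (\<lambda>k. gauss (\<mu> k) (\<sigma> k)) is" x
        "\<lambda>i j. gauss_poly (\<mu> (is ! j)) (\<sigma> (is ! j)) i x"]
    by (simp add: higher_deriv_gauss_eq_gauss_poly gauss_Q_def)
  then show ?thesis
    by (simp add: prod.list_conv_set_nth atLeast0LessThan)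
qed

section \<open>Evaluation of the sequence on a Gaussian mixture\<close>

theorem theorem13:
  fixes n :: nat and \<gamma> \<mu> \<sigma> :: "nat \<Rightarrow> real"
    and h :: "nat \<Rightarrow> real \<Rightarrow> real" and f :: "real \<Rightarrow> real"
  assumes h_eq: "\<And>k. h k = gauss (\<mu> k) (\<sigma> k)"
    and sigma_pos: "\<And>k. k \<in> {1..n} \<Longrightarrow> \<sigma> k > 0"
    and h_distinct: "\<And>i j. i \<in> {1..n} \<Longrightarrow> j \<in> {1..n} \<Longrightarrow> i \<noteq> j \<Longrightarrow> h i \<noteq> h j"
    and normalized: "(\<Sum>k = 1..n. \<sigma> k * \<gamma> k) = 1 / sqrt (2 * pi)"
    and f_eq: "\<And>x. f x = (\<Sum>k = 1..n. \<gamma> k * h k x)"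
  shows "budan_fourier_seq h f 0 = f \<and>
    (\<forall>j x. 1 \<le> j \<and> j < n \<and>
        (\<forall>i \<in> {1..j}. initial_wronskian h i x \<noteq> 0) \<and>
        gauss_Q \<mu> \<sigma> [1..<Suc j] x \<noteq> 0 \<longrightarrow>
      budan_fourier_seq h f j x =
        (\<Sum>k = Suc j..n. \<gamma> k *
          (gauss_Q \<mu> \<sigma> ([1..<Suc j] @ [k]) x / gauss_Q \<mu> \<sigma> [1..<Suc j] x) * h k x))"
proof (intro conjI allI impI)
  show "budan_fourier_seq h f 0 = f" by simp
next
  fix j x
  assume "1 \<le> j \<and> j < n \<and> (\<forall>i \<in> {1..j}. initial_wronskian h i x \<noteq> 0) \<and>
    gauss_Q \<mu> \<sigma> [1..<Suc j] x \<noteq> 0"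
  then have j: "1 \<le> j" "j < n" and W: "\<And>i. i \<in> {1..j} \<Longrightarrow> initial_wronskian h i x \<noteq> 0"
    by auto
  let ?H = "map h [1..<Suc j]"
  \<comment> \<open>By linearity, \<open>w k\<close> is what \<open>h k\<close> contributes, up to
    the weight \<open>\<gamma> k\<close>.\<close>
  define w where "w k = wronskian (?H @ [h k]) x / initial_wronskian h j x" for k
  have h: "h = (\<lambda>k. gauss (\<mu> k) (\<sigma> k))" using h_eq by auto
  have smooth: "infinitely_differentiable (h k)" for k
    by (simp add: h_eq infinitely_differentiable_gauss)
  have f: "f = (\<lambda>x. \<Sum>k = 1..n. \<gamma> k * h k x)" using f_eq by auto
  \<comment> \<open>A repeated column removes the first \<open>j\<close> terms, so the final sum
    starts at \<open>Suc j\<close>.\<close>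
  have w_vanishes: "w k = 0" if "k \<in> {1..j}" for k
  proof -
    have "h k \<in> set ?H" using that by (auto simp del: upt_Suc)
    then show ?thesis by (simp add: w_def wronskian_append_in_set)
  qed
  have w_eq: "w k = gauss_Q \<mu> \<sigma> ([1..<Suc j] @ [k]) x / gauss_Q \<mu> \<sigma> [1..<Suc j] x * h k x" for k
  proof -
    \<comment> \<open>This product is a common factor of both Wronskians in \<open>w k\<close>; it
      cancels and leaves only the extra factor \<open>h k x\<close> of the numerator.\<close>
    have "(\<Prod>k\<leftarrow>[1..<Suc j]. h k x) \<noteq> 0"
      by (auto simp: prod_list_zero_iff h_eq gauss_def simp del: upt_Suc)
    then show ?thesis
      using wronskian_gauss[of \<mu> \<sigma> "[1..<Suc j]" x]
        wronskian_gauss[of \<mu> \<sigma> "[1..<Suc j] @ [k]" x]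
      by (simp add: w_def initial_wronskian_def flip: h h_eq del: upt_Suc)
  qed
  have "budan_fourier_seq h f j x = wronskian (?H @ [f]) x / initial_wronskian h j x"
    by (intro budan_fourier_seq_eq_wronskian smooth W)
      (auto simp: f intro: infinitely_differentiable_linear_combination smooth)
  also have "wronskian (?H @ [f]) x = (\<Sum>k = 1..n. \<gamma> k * wronskian (?H @ [h k]) x)"
    unfolding f by (intro wronskian_append_linear_combination) (auto intro: smooth)
  also have "\<dots> / initial_wronskian h j x = (\<Sum>k = 1..n. \<gamma> k * w k)"
    by (simp add: w_def sum_divide_distrib)
  also have "\<dots> = (\<Sum>k = Suc j..n. \<gamma> k * w k)"
    using j by (intro sum.mono_neutral_right) (auto simp: w_vanishes)
  finally show "budan_fourier_seq h f j x = (\<Sum>k = Suc j..n. \<gamma> k *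
      (gauss_Q \<mu> \<sigma> ([1..<Suc j] @ [k]) x / gauss_Q \<mu> \<sigma> [1..<Suc j] x) * h k x)"
    by (simp add: w_eq mult.assoc)
qed

end
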